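(* There exists an absolute constant $c>0$ such that for all primes $q$, $$\mathrm{IM}(2,q)\ \ge\ c\,q^{1.2334}.$$
   Context: For an integer $d\ge 1$ and a prime power $q$, $\mathrm{IM}(d,q)$ denotes the maximum size of an induced matching in the bipartite point-line incidence graph of $\mathbb{F}_q^d$ (points of $\mathbb{F}_q^d$ on one side, affine lines of $\mathbb{F}_q^d$ on the other, a point adjacent to a line iff it lies on it). Equivalently, $\mathrm{IM}(d,q)$ is the largest $m$ for which there exist pairs $(p_1,\ell_1),\dots,(p_m,\ell_m)$ with $p_i\in\mathbb{F}_q^d$ points and $\ell_j\subset\mathbb{F}_q^d$ affine lines such that $p_i\in\ell_j$ if and only if $i=j$. *)

theory Defs
  imports Complex_Main "HOL-Library.FuncSet" "HOL-Library.Disjoint_Sets"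
    "HOL-Number_Theory.Residues"
begin

text \<open>
  A simple graph is given by its set of edges, each edge being the set of its two endpoints.
  The last clause of \<open>induced_matching\<close> says that the subgraph induced on the
  vertices covered by \<open>M\<close> has no edges other than those of \<open>M\<close>.
\<close>

definition induced_matching :: "'v set set \<Rightarrow> 'v set set \<Rightarrow> bool" where
  "induced_matching E M \<longleftrightarrow>
     M \<subseteq> E \<and> disjoint M \<and> (\<forall>e\<in>E. e \<subseteq> \<Union>M \<longrightarrow> e \<in> M)"

text \<open>
  The affine space \<open>R\<^sup>d\<close> over a field \<open>R\<close>. Vectors are extensional functions
  on \<open>{..<d}\<close>, so that equality of points is equality of coordinates.
\<close>

definition points :: "('a, 'b) ring_scheme \<Rightarrow> nat \<Rightarrow> (nat \<Rightarrow> 'a) set" where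
  "points R d = {..<d} \<rightarrow>\<^sub>E carrier R"

definition line_through ::
    "('a, 'b) ring_scheme \<Rightarrow> nat \<Rightarrow> (nat \<Rightarrow> 'a) \<Rightarrow> (nat \<Rightarrow> 'a) \<Rightarrow> (nat \<Rightarrow> 'a) set" where
  "line_through R d a v =
     (\<lambda>t. \<lambda>i\<in>{..<d}. a i \<oplus>\<^bsub>R\<^esub> t \<otimes>\<^bsub>R\<^esub> v i) ` carrier R"

definition affine_lines :: "('a, 'b) ring_scheme \<Rightarrow> nat \<Rightarrow> (nat \<Rightarrow> 'a) set set" where
  "affine_lines R d =
     {line_through R d a v | a v.
        a \<in> points R d \<and> v \<in> points R d \<and> v \<noteq> (\<lambda>i\<in>{..<d}. \<zero>\<^bsub>R\<^esub>)}"

text \<open>Points are tagged by \<open>Inl\<close> and lines by \<open>Inr\<close>.\<close>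

definition incidence_edges ::
    "('a, 'b) ring_scheme \<Rightarrow> nat \<Rightarrow> ((nat \<Rightarrow> 'a) + (nat \<Rightarrow> 'a) set) set set" where
  "incidence_edges R d =
     {{Inl p, Inr l} | p l. p \<in> points R d \<and> l \<in> affine_lines R d \<and> p \<in> l}"

text \<open>
  \<open>IM R d\<close> is meant for finite \<open>R\<close>, where the maximum is over a finite nonempty set;
  for a field \<open>R\<close> with \<open>q\<close> elements it is IM(d,q).
\<close>

definition IM :: "('a, 'b) ring_scheme \<Rightarrow> nat \<Rightarrow> nat" where
  "IM R d = Max {card M | M. induced_matching (incidence_edges R d) M}"

lemma finite_incidence_edges:
  assumes "finite (carrier R)"
  shows "finite (incidence_edges R d)"
proof -
  have fp: "finite (points R d)"
    unfolding points_def using assms by (intro finite_PiE) auto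
  have "affine_lines R d \<subseteq> (\<lambda>(a, v). line_through R d a v) ` (points R d \<times> points R d)"
    unfolding affine_lines_def by auto
  then have fl: "finite (affine_lines R d)"
    using fp by (meson finite_SigmaI finite_imageI finite_subset)
  have "incidence_edges R d \<subseteq> (\<lambda>(p, l). {Inl p, Inr l}) ` (points R d \<times> affine_lines R d)"
    unfolding incidence_edges_def by auto
  then show ?thesis
    using fp fl by (meson finite_SigmaI finite_imageI finite_subset)
qed

lemma finite_induced_matching_cards:
  assumes "finite (carrier R)"
  shows "finite {card M | M. induced_matching (incidence_edges R d) M}"
proof -
  have "{card M | M. induced_matching (incidence_edges R d) M} \<subseteq> card ` Pow (incidence_edges R d)"
    by (auto simp: induced_matching_def)
  then show ?thesis
    using finite_incidence_edges[OF assms] by (meson finite_Pow_iff finite_imageI finite_subset)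
qed

lemma induced_matching_empty: "induced_matching (incidence_edges R d) {}"
  by (auto simp: induced_matching_def incidence_edges_def disjoint_def)

lemma induced_matching_of_pairs:
  fixes p :: "nat \<Rightarrow> nat \<Rightarrow> 'a" and l :: "nat \<Rightarrow> (nat \<Rightarrow> 'a) set"
  assumes pts: "\<forall>i<m. p i \<in> points R d" and lns: "\<forall>j<m. l j \<in> affine_lines R d"
    and inc: "\<forall>i<m. \<forall>j<m. p i \<in> l j \<longleftrightarrow> i = j"
  shows "\<exists>M. induced_matching (incidence_edges R d) M \<and> card M = m"
proof -
  define e :: "nat \<Rightarrow> ((nat \<Rightarrow> 'a) + (nat \<Rightarrow> 'a) set) set"
    where "e i = {Inl (p i), Inr (l i)}" for i
  have ij: "i = j" if "i < m" "j < m" "e i \<inter> e j \<noteq> {}" for i j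
  proof -
    have "p i = p j \<or> l i = l j" using that(3) by (auto simp: e_def)
    then show ?thesis using inc that(1,2) by metis
  qed
  have inj: "inj_on e {..<m}"
  proof (rule inj_onI)
    fix i j assume "i \<in> {..<m}" "j \<in> {..<m}" "e i = e j"
    moreover have "e i \<noteq> {}" by (simp add: e_def)
    ultimately show "i = j" using ij[of i j] by simp
  qed
  have "induced_matching (incidence_edges R d) (e ` {..<m})"
    unfolding induced_matching_def
  proof (intro conjI ballI impI)
    show "e ` {..<m} \<subseteq> incidence_edges R d"
      using pts lns inc by (fastforce simp: e_def incidence_edges_def)
    show "disjoint (e ` {..<m})"
      unfolding disjoint_def using ij by blast
  next
    fix x assume x: "x \<in> incidence_edges R d" "x \<subseteq> \<Union> (e ` {..<m})"
    obtain a b where ab: "x = {Inl a, Inr b}" "a \<in> b"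
      using x(1) by (auto simp: incidence_edges_def)
    obtain i j where "i < m" "j < m" "a = p i" "b = l j"
      using x(2) ab(1) by (auto simp: e_def)
    with inc ab show "x \<in> e ` {..<m}" by (auto simp: e_def)
  qed
  moreover have "card (e ` {..<m}) = m" using inj by (simp add: card_image)
  ultimately show ?thesis by blast
qed

lemma pairs_of_induced_matching:
  fixes R :: "('a, 'b) ring_scheme"
  assumes fin: "finite (carrier R)" and M: "induced_matching (incidence_edges R d) M"
    and m: "m \<le> card M"
  shows "\<exists>p l. (\<forall>i<m. p i \<in> points R d) \<and> (\<forall>j<m. l j \<in> affine_lines R d) \<and>
           (\<forall>i<m. \<forall>j<m. p i \<in> l j \<longleftrightarrow> i = j)"
proof -
  have sub: "M \<subseteq> incidence_edges R d" and dis: "disjoint M"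
    and ind: "\<And>e. e \<in> incidence_edges R d \<Longrightarrow> e \<subseteq> \<Union>M \<Longrightarrow> e \<in> M"
    using M by (auto simp: induced_matching_def)
  have "finite M" using sub finite_incidence_edges[OF fin] by (rule finite_subset)
  then obtain e where e: "bij_betw e {0..<card M} M"
    using ex_bij_betw_nat_finite by blast
  have "\<forall>i<m. \<exists>p l. e i = {Inl p, Inr l} \<and> p \<in> points R d \<and> l \<in> affine_lines R d \<and> p \<in> l"
  proof (intro allI impI)
    fix i assume "i < m"
    then have "e i \<in> incidence_edges R d" using e m sub by (auto simp: bij_betw_def)
    then show "\<exists>p l. e i = {Inl p, Inr l} \<and> p \<in> points R d \<and> l \<in> affine_lines R d \<and> p \<in> l"
      by (auto simp: incidence_edges_def)
  qed
  then obtain p l where pl: "\<And>i. i < m \<Longrightarrow>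
      e i = {Inl (p i), Inr (l i)} \<and> p i \<in> points R d \<and> l i \<in> affine_lines R d \<and> p i \<in> l i"
    by metis
  have "i = j" if "i < m" "j < m" "p i \<in> l j" for i j
  proof -
    have eM: "e i \<in> M" "e j \<in> M" using that e m by (auto simp: bij_betw_def)
    have "{Inl (p i), Inr (l j)} \<in> M"
    proof (rule ind)
      show "{Inl (p i), Inr (l j)} \<in> incidence_edges R d"
        using pl that by (auto simp: incidence_edges_def)
      show "{Inl (p i), Inr (l j)} \<subseteq> \<Union>M"
        using pl[OF that(1)] pl[OF that(2)] eM by auto
    qed
    moreover have "{Inl (p i), Inr (l j)} \<inter> e i \<noteq> {}" "{Inl (p i), Inr (l j)} \<inter> e j \<noteq> {}"
      using pl that by auto
    ultimately have "e i = e j" using eM dis unfolding disjoint_def by metis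
    then show ?thesis using e that m by (auto simp: bij_betw_def inj_on_def)
  qed
  then show ?thesis using pl by metis
qed

text \<open>The description of IM by point-line pairs, as a check on the definition.\<close>

lemma le_IM_iff:
  fixes R :: "('a, 'b) ring_scheme"
  assumes fin: "finite (carrier R)"
  shows "m \<le> IM R d \<longleftrightarrow>
    (\<exists>p l. (\<forall>i<m. p i \<in> points R d) \<and> (\<forall>j<m. l j \<in> affine_lines R d) \<and>
       (\<forall>i<m. \<forall>j<m. p i \<in> l j \<longleftrightarrow> i = j))" (is "_ \<longleftrightarrow> ?P")
proof -
  let ?S = "{card M | M. induced_matching (incidence_edges R d) M}"
  have S: "finite ?S" "?S \<noteq> {}"
    using finite_induced_matching_cards[OF fin] induced_matching_empty by auto
  show ?thesis
  proof
    assume "m \<le> IM R d"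
    moreover have "IM R d \<in> ?S" unfolding IM_def using S by (rule Max_in)
    ultimately obtain M where "induced_matching (incidence_edges R d) M" "m \<le> card M"
      by auto
    then show ?P by (rule pairs_of_induced_matching[OF fin])
  next
    assume ?P
    then obtain M where "induced_matching (incidence_edges R d) M" "card M = m"
      using induced_matching_of_pairs by metis
    then have "m \<in> ?S" by auto
    then show "m \<le> IM R d" unfolding IM_def using S(1) by (intro Max_ge)
  qed
qed

end

theory Submission
  imports Defs "HOL-Computational_Algebra.Squarefree"
begin

text \<open>
  Translates of the parabola by a set \<open>A\<close> without square differences: the tangent to
  \<open>y = x\<^sup>2 + a\<close> at \<open>u\<close> meets \<open>y = x\<^sup>2 + a'\<close> at \<open>x = u'\<close> iff \<open>(u' - u)\<^sup>2 = a - a'\<close>.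
  If \<open>A \<subseteq> [0, N)\<close>, \<open>u, u' \<in> [0, \<surd>N)\<close> and \<open>2 N \<le> q\<close>, this equation modulo \<open>q\<close> already holds
  in the integers, so the points of tangency and the tangents form an induced matching of size
  \<open>\<surd>N \<bar>A\<bar>\<close>. For \<open>A\<close> take Ruzsa's set: with \<open>m\<close> squarefree, the numbers whose base-\<open>m\<close>
  digits in even positions lie in a set of residues without square differences modulo \<open>m\<close>.
  Lewko's modulus 205 admits twelve residues, which gives
  \<open>\<bar>A\<bar> = N powr ((1 + log 205 12) / 2)\<close>, and \<open>(1 + log 205 12) / 2 > 0.7334\<close>.
\<close>

section \<open>Ruzsa's sets without square differences\<close>

definition square_difference_free :: "int set \<Rightarrow> bool" where
  "square_difference_free A \<longleftrightarrow> (\<forall>a\<in>A. \<forall>b\<in>A. \<forall>y. a - b = y\<^sup>2 \<longrightarrow> a = b)"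

definition square_difference_free_mod :: "int \<Rightarrow> int set \<Rightarrow> bool" where
  "square_difference_free_mod m R \<longleftrightarrow> (\<forall>r\<in>R. \<forall>s\<in>R. \<forall>y. [r - s = y\<^sup>2] (mod m) \<longrightarrow> r = s)"

text \<open>Each step adds two digits at the low end, the lower one from \<open>R\<close> and the
  next one free, so a factor \<open>m * m\<close> separates consecutive stages, as it separates
  \<open>(m * z)\<^sup>2\<close> from \<open>z\<^sup>2\<close>.\<close>

fun ruzsa :: "int \<Rightarrow> int set \<Rightarrow> nat \<Rightarrow> int set" where
  "ruzsa m R 0 = {0}"
| "ruzsa m R (Suc k) = (\<lambda>(r, t, s). r + m * (t + m * s)) ` (R \<times> {0..<m} \<times> ruzsa m R k)"

lemma add_mult_eq_iff:
  fixes m r r' s s' :: int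
  assumes "r \<in> {0..<m}" "r' \<in> {0..<m}"
  shows "r + m * s = r' + m * s' \<longleftrightarrow> r = r' \<and> s = s'"
proof
  assume eq: "r + m * s = r' + m * s'"
  have "(r + m * s) mod m = r" "(r' + m * s') mod m = r'"
    using assms by auto
  with eq have "r = r'" by simp
  with eq assms show "r = r' \<and> s = s'" by auto
qed simp

lemma add_mult_bounds:
  fixes m n r s :: int
  assumes "r \<in> {0..<m}" "s \<in> {0..<n}"
  shows "r + m * s \<in> {0..<m * n}"
proof -
  have "m * (s + 1) \<le> m * n" using assms by (intro mult_left_mono) auto
  with assms show ?thesis by (auto simp: algebra_simps)
qed

lemma ruzsa_subset:
  assumes "R \<subseteq> {0..<m}"
  shows "ruzsa m R k \<subseteq> {0..<(m * m) ^ k}"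
proof (induction k)
  case (Suc k)
  show ?case
  proof
    fix a assume "a \<in> ruzsa m R (Suc k)"
    then obtain r t s where a: "a = r + m * (t + m * s)"
      and "r \<in> R" "t \<in> {0..<m}" "s \<in> ruzsa m R k"
      by auto
    then have "r \<in> {0..<m}" "t \<in> {0..<m}" "s \<in> {0..<(m * m) ^ k}"
      using assms Suc by blast+
    then have "a \<in> {0..<m * (m * (m * m) ^ k)}"
      unfolding a by (intro add_mult_bounds)
    then show "a \<in> {0..<(m * m) ^ Suc k}" by (simp add: mult.assoc)
  qed
qed simp

lemma card_ruzsa:
  assumes "R \<subseteq> {0..<m}"
  shows "card (ruzsa m R k) = (card R * nat m) ^ k"
proof (induction k)
  case (Suc k)
  have "inj_on (\<lambda>(r, t, s). r + m * (t + m * s)) (R \<times> {0..<m} \<times> ruzsa m R k)"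
    using assms by (auto simp: inj_on_def add_mult_eq_iff subset_iff)
  then have "card (ruzsa m R (Suc k)) = card R * (nat m * card (ruzsa m R k))"
    by (simp add: card_image card_cartesian_product)
  then show ?case using Suc by simp
qed simp

text \<open>Every prime factor of \<open>m\<close> occurs in \<open>m\<close> exactly once, and a
  prime dividing \<open>y\<^sup>2\<close> divides \<open>y\<close>.\<close>

lemma squarefree_dvd_square_imp_dvd:
  fixes m y :: "'a :: factorial_semiring"
  assumes "squarefree m" "m dvd y\<^sup>2"
  shows "m dvd y"
proof (cases "y = 0")
  case False
  have "m \<noteq> 0" using assms(1) by auto
  show ?thesis
  proof (rule multiplicity_le_imp_dvd)
    fix p :: 'a assume p: "prime p"
    show "multiplicity p m \<le> multiplicity p y"
    proof (cases "p dvd m")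
      case True
      then have "p dvd y\<^sup>2" using assms(2) by (rule dvd_trans)
      then have "p dvd y" using p prime_dvd_power by blast
      then have "1 \<le> multiplicity p y"
        using p False by (intro multiplicity_geI) auto
      moreover have "multiplicity p m \<le> 1"
        using assms(1) p \<open>m \<noteq> 0\<close> squarefree_factorial_semiring'' by blast
      ultimately show ?thesis by simp
    qed (simp add: not_dvd_imp_multiplicity_0)
  qed (use \<open>m \<noteq> 0\<close> in auto)
qed simp

text \<open>Descent on digits: reduction modulo \<open>m\<close> forces equal lowest digits, then
  \<open>m\<close> divides \<open>y\<close> and \<open>y\<^sup>2\<close> is a multiple of
  \<open>m * m\<close>, which forces equal second digits; the higher parts then differ by the square
  \<open>(y / m)\<^sup>2\<close>.\<close>

lemma square_difference_free_ruzsa: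
  assumes m: "squarefree m" and R: "R \<subseteq> {0..<m}" "square_difference_free_mod m R"
  shows "square_difference_free (ruzsa m R k)"
proof (induction k)
  case 0
  show ?case by (simp add: square_difference_free_def)
next
  case (Suc k)
  show ?case unfolding square_difference_free_def
  proof (intro ballI allI impI)
    fix a a' y assume "a \<in> ruzsa m R (Suc k)" "a' \<in> ruzsa m R (Suc k)" and y: "a - a' = y\<^sup>2"
    then obtain r t s r' t' s' where
      a: "a = r + m * (t + m * s)" "r \<in> R" "t \<in> {0..<m}" "s \<in> ruzsa m R k" and
      a': "a' = r' + m * (t' + m * s')" "r' \<in> R" "t' \<in> {0..<m}" "s' \<in> ruzsa m R k"
      by auto
    have "m > 0" using a by auto
    have "r - r' - y\<^sup>2 = m * (t' + m * s' - (t + m * s))"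
      using y a(1) a'(1) by (simp add: algebra_simps)
    then have "[r - r' = y\<^sup>2] (mod m)" by (simp add: cong_iff_dvd_diff)
    then have r: "r = r'" using R(2) a(2) a'(2) by (auto simp: square_difference_free_mod_def)
    then have y': "y\<^sup>2 = m * (t - t' + m * (s - s'))"
      using y a(1) a'(1) by (simp add: algebra_simps)
    then have "m dvd y\<^sup>2" by (rule dvdI)
    with m have "m dvd y" by (rule squarefree_dvd_square_imp_dvd)
    then obtain z where z: "y = m * z" by blast
    then have "m * (m * z\<^sup>2) = m * (t - t' + m * (s - s'))"
      using y' by (simp add: power2_eq_square mult_ac)
    then have "m * z\<^sup>2 = t - t' + m * (s - s')"
      using \<open>m > 0\<close> by (simp only: mult_cancel_left) simp
    \<comment> \<open>Both sides are divisions by \<open>m\<close> with remainders \<open>t\<close>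
      and \<open>t'\<close>, so remainders and quotients agree.\<close>
    then have "t + m * s = t' + m * (z\<^sup>2 + s')" by (simp add: algebra_simps)
    then have t: "t = t'" and "s = z\<^sup>2 + s'"
      using a(3) a'(3) by (auto simp: add_mult_eq_iff)
    then have "s = s'" using Suc a(4) a'(4) by (force simp: square_difference_free_def)
    then show "a = a'" using r t a(1) a'(1) by simp
  qed
qed

section \<open>Lewko's residues modulo 205 = 5 * 41\<close>

definition lewko_residues :: "int set" where
  "lewko_residues = {0, 2, 8, 14, 77, 79, 85, 96, 103, 109, 111, 181}"

lemma square_mod_5: "(y\<^sup>2 mod 5 :: int) \<in> {0, 1, 4}"
proof -
  have "y mod 5 \<in> set [0..4]" by auto
  then have "y mod 5 \<in> {0, 1, 2, 3, 4}" by (simp add: upto.simps)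
  then have "(y mod 5)\<^sup>2 mod 5 \<in> {0, 1, 4}" by auto
  then show ?thesis by (simp add: power_mod)
qed

lemma square_mod_41:
  "(y\<^sup>2 mod 41 :: int) \<in>
    {0, 1, 2, 4, 5, 8, 9, 10, 16, 18, 20, 21, 23, 25, 31, 32, 33, 36, 37, 39, 40}"
  (is "_ \<in> ?S")
proof -
  have "\<forall>z\<in>set [0..40]. z\<^sup>2 mod 41 \<in> ?S"
    by (simp add: upto.simps)
  moreover have "y mod 41 \<in> set [0..40]" by auto
  ultimately have "(y mod 41)\<^sup>2 mod 41 \<in> ?S" by blast
  then show ?thesis by (simp only: power_mod)
qed

text \<open>A square modulo 205 is a square modulo both 5 and 41, and each difference of distinct
  residues fails one of the two tests. This leaves a finite check of 144 pairs.\<close>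

lemma square_difference_free_mod_lewko: "square_difference_free_mod 205 lewko_residues"
  unfolding square_difference_free_mod_def
proof (intro ballI allI impI)
  fix r s y assume rs: "r \<in> lewko_residues" "s \<in> lewko_residues" and "[r - s = y\<^sup>2] (mod 205)"
  then have c: "[r - s = y\<^sup>2] (mod 5)" "[r - s = y\<^sup>2] (mod 41)"
    by (auto intro: cong_dvd_modulus)
  let ?S5 = "{0, 1, 4} :: int set"
  let ?S41 = "{0, 1, 2, 4, 5, 8, 9, 10, 16, 18, 20, 21, 23, 25, 31, 32, 33, 36, 37, 39, 40} :: int set"
  have "(r - s) mod 5 \<in> ?S5" "(r - s) mod 41 \<in> ?S41"
    using square_mod_5[of y] square_mod_41[of y] c unfolding cong_def by metis+
  moreover have table: "\<forall>r\<in>lewko_residues. \<forall>s\<in>lewko_residues.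
      (r - s) mod 5 \<in> ?S5 \<longrightarrow> (r - s) mod 41 \<in> ?S41 \<longrightarrow> r = s"
    by code_simp
  ultimately show "r = s" using rs by (intro table[rule_format])
qed

lemma squarefree_205: "squarefree (205 :: int)"
proof -
  have "squarefree (5 * 41 :: int)"
    by (intro squarefree_mult_coprime squarefree_prime) (auto intro: primes_coprime)
  then show ?thesis by simp
qed

section \<open>Tangents to translated parabolas modulo \<open>q\<close> as an induced
  matching\<close>

lemma card_le_IM:
  fixes R :: "('a, 'b) ring_scheme" and p :: "'i \<Rightarrow> nat \<Rightarrow> 'a"
  assumes "finite (carrier R)" "finite I"
    and "\<And>i. i \<in> I \<Longrightarrow> p i \<in> points R d" "\<And>i. i \<in> I \<Longrightarrow> l i \<in> affine_lines R d"
    and "\<And>i j. i \<in> I \<Longrightarrow> j \<in> I \<Longrightarrow> p i \<in> l j \<longleftrightarrow> i = j"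
  shows "card I \<le> IM R d"
proof -
  obtain h where h: "bij_betw h {0..<card I} I"
    using ex_bij_betw_nat_finite assms(2) by blast
  then have hI: "h i \<in> I" if "i < card I" for i using that by (auto simp: bij_betw_def)
  have "h i = h j \<longleftrightarrow> i = j" if "i < card I" "j < card I" for i j
    using h that by (auto simp: bij_betw_def inj_on_def)
  then show ?thesis unfolding le_IM_iff[OF assms(1)]
    using assms hI by (intro exI[of _ "p \<circ> h"] exI[of _ "l \<circ> h"]) auto
qed

text \<open>Reducing the coordinates here lets all later computations use integers, with equality of
  points becoming congruence.\<close>

definition plane_point :: "int \<Rightarrow> int \<Rightarrow> int \<Rightarrow> nat \<Rightarrow> int" where
  "plane_point q x y = (\<lambda>i\<in>{..<2}. (if i = 0 then x else y) mod q)"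

lemma carrier_residue_ring: "carrier (residue_ring q) = {0..<q}"
  by (auto simp: residue_ring_def)

lemma plane_point_in_points: "q > 0 \<Longrightarrow> plane_point q x y \<in> points (residue_ring q) 2"
  by (auto simp: plane_point_def points_def carrier_residue_ring)

lemma plane_point_eq_iff:
  "plane_point q x y = plane_point q x' y' \<longleftrightarrow> [x = x'] (mod q) \<and> [y = y'] (mod q)"
  by (force simp: plane_point_def cong_def restrict_def fun_eq_iff)

lemma line_through_plane_point:
  "line_through (residue_ring q) 2 (plane_point q x y) (plane_point q u v) =
     (\<lambda>t. plane_point q (x + t * u) (y + t * v)) ` {0..<q}"
proof -
  have "(a + t * (b mod q)) mod q = (a + t * b) mod q" for a b t
    by (metis mod_add_right_eq mod_mult_right_eq)
  then show ?thesis
    unfolding line_through_def carrier_residue_ring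
    by (intro image_cong refl ext) (auto simp: plane_point_def residue_ring_def mod_simps)
qed

lemma tangent_incidence_iff:
  assumes "q > 0"
  shows "plane_point q x' (x'\<^sup>2 + a') \<in>
      line_through (residue_ring q) 2 (plane_point q x (x\<^sup>2 + a)) (plane_point q 1 (2 * x)) \<longleftrightarrow>
    [(x' - x)\<^sup>2 = a - a'] (mod q)" (is "?L \<longleftrightarrow> ?R")
proof
  assume ?L
  then obtain t where t: "[x' = x + t] (mod q)" "[x'\<^sup>2 + a' = x\<^sup>2 + a + t * (2 * x)] (mod q)"
    by (auto simp: line_through_plane_point plane_point_eq_iff)
  \<comment> \<open>Subtracting \<open>2 * x\<close> times the first congruence from the second
    eliminates \<open>t\<close>.\<close>
  then have "q dvd x'\<^sup>2 + a' - (x\<^sup>2 + a + t * (2 * x)) - (x' - (x + t)) * (2 * x)"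
    unfolding cong_iff_dvd_diff by (intro dvd_diff[OF _ dvd_mult2])
  also have "\<dots> = (x' - x)\<^sup>2 - (a - a')" by (simp add: power2_eq_square algebra_simps)
  finally show ?R by (simp add: cong_iff_dvd_diff)
next
  assume ?R
  \<comment> \<open>The first coordinate dictates the parameter; it is reduced to lie in
    \<open>{0..<q}\<close>.\<close>
  define t where "t = (x' - x) mod q"
  have "[t = x' - x] (mod q)" by (simp add: t_def)
  then have "[x + t = x + (x' - x)] (mod q)"
    "[x\<^sup>2 + a + t * (2 * x) = x\<^sup>2 + a + (x' - x) * (2 * x)] (mod q)"
    by (intro cong_add cong_mult cong_refl; assumption)+
  moreover have "[x\<^sup>2 + a + (x' - x) * (2 * x) = x'\<^sup>2 + a'] (mod q)"
    using \<open>?R\<close> by (simp add: cong_iff_dvd_diff power2_eq_square algebra_simps dvd_diff_commute)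
  ultimately have "plane_point q x' (x'\<^sup>2 + a') = plane_point q (x + t * 1) (x\<^sup>2 + a + t * (2 * x))"
    unfolding plane_point_eq_iff by (auto intro: cong_sym cong_trans)
  moreover have "t \<in> {0..<q}" using assms by (simp add: t_def)
  ultimately show ?L unfolding line_through_plane_point by blast
qed

lemma card_square_difference_free_le_IM:
  fixes q N X :: int
  assumes A: "square_difference_free A" "A \<subseteq> {0..<N}" and X: "X\<^sup>2 \<le> N" and q: "2 * N \<le> q" "q > 1"
  shows "nat X * card A \<le> IM (residue_ring q) 2"
proof -
  define p where "p = (\<lambda>(x, a). plane_point q x (x\<^sup>2 + a))"
  define l where "l = (\<lambda>(x, a). line_through (residue_ring q) 2 (plane_point q x (x\<^sup>2 + a))
    (plane_point q 1 (2 * x)))"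
  have "card ({0..<X} \<times> A) \<le> IM (residue_ring q) 2"
  proof (rule card_le_IM)
    show "finite (carrier (residue_ring q))" by (simp add: carrier_residue_ring)
    show "finite ({0..<X} \<times> A)" using A(2) finite_subset by auto
    show "p i \<in> points (residue_ring q) 2" for i
      using q by (auto simp: p_def plane_point_in_points split: prod.split)
    \<comment> \<open>A tangent direction has first coordinate 1, which is nonzero modulo
      \<open>q\<close> as \<open>q > 1\<close>.\<close>
    have "plane_point q 1 v \<noteq> (\<lambda>i\<in>{..<2}. \<zero>\<^bsub>residue_ring q\<^esub>)" for v
    proof
      assume "plane_point q 1 v = (\<lambda>i\<in>{..<2}. \<zero>\<^bsub>residue_ring q\<^esub>)"
      then have "plane_point q 1 v 0 = 0" by (simp add: residue_ring_def)
      then show False using q by (simp add: plane_point_def)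
    qed
    then show "l i \<in> affine_lines (residue_ring q) 2" for i
      using q unfolding affine_lines_def l_def
      by (auto split: prod.split intro!: exI plane_point_in_points)
    show "p i \<in> l j \<longleftrightarrow> i = j" if i: "i \<in> {0..<X} \<times> A" and j: "j \<in> {0..<X} \<times> A" for i j
    proof -
      obtain x a x' a' where ij: "j = (x, a)" "i = (x', a')" by (cases i, cases j) auto
      have xa: "x \<in> {0..<X}" "x' \<in> {0..<X}" "a \<in> A" "a' \<in> A" "a \<in> {0..<N}" "a' \<in> {0..<N}"
        using i j ij A(2) by auto
      have "[(x' - x)\<^sup>2 = a - a'] (mod q) \<longleftrightarrow> (x', a') = (x, a)"
      proof
        assume c: "[(x' - x)\<^sup>2 = a - a'] (mod q)"
        have "\<bar>x' - x\<bar> < X" using xa by auto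
        then have "\<bar>x' - x\<bar>\<^sup>2 < X\<^sup>2" by (intro power_strict_mono) auto
        then have "(x' - x)\<^sup>2 < N" using X by simp
        moreover have "0 \<le> (x' - x)\<^sup>2" "\<bar>a - a'\<bar> < N" using xa by auto
        \<comment> \<open>A number in \<open>[0, N)\<close> and one in \<open>(-N, N)\<close> differ
          by less than \<open>2 * N\<close>, so congruence modulo \<open>q\<close> makes them
          equal.\<close>
        ultimately have "\<bar>(x' - x)\<^sup>2 - (a - a')\<bar> < q" using q(1) by linarith
        then have eq: "a - a' = (x' - x)\<^sup>2"
          using c zdvd_imp_le[of q "\<bar>(x' - x)\<^sup>2 - (a - a')\<bar>"] by (force simp: cong_iff_dvd_diff)
        then have "a = a'" using A(1) xa by (auto simp: square_difference_free_def)
        with eq show "(x', a') = (x, a)" by simp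
      qed simp
      then show ?thesis using q by (simp add: ij p_def l_def tangent_incidence_iff)
    qed
  qed
  then show ?thesis by (simp add: card_cartesian_product)
qed

section \<open>The size of the matching and its exponent\<close>

lemma power_le_IM:
  assumes "2 * 42025 ^ k \<le> q" "q > 1"
  shows "504300 ^ k \<le> IM (residue_ring (int q)) 2"
proof -
  let ?A = "ruzsa 205 lewko_residues k"
  have R: "lewko_residues \<subseteq> {0..<205}" "card lewko_residues = 12"
    by (simp_all add: lewko_residues_def)
  have "2 * 42025 ^ k \<le> int q"
    using assms(1) by (metis of_nat_le_iff of_nat_mult of_nat_numeral of_nat_power)
  moreover have "?A \<subseteq> {0..<42025 ^ k}" using ruzsa_subset[OF R(1), of k] by simp
  \<comment> \<open>Since 42025 = 205 * 205, \<open>X = 205 ^ k\<close> is the exact square root of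
    \<open>N = 42025 ^ k\<close>.\<close>
  moreover have "((205 :: int) ^ k)\<^sup>2 \<le> 42025 ^ k"
    by (simp add: power2_eq_square flip: power_mult_distrib)
  ultimately have "nat (205 ^ k) * card ?A \<le> IM (residue_ring (int q)) 2"
    using assms(2) square_difference_free_ruzsa[OF squarefree_205 R(1) square_difference_free_mod_lewko]
    by (intro card_square_difference_free_le_IM[of _ "42025 ^ k"]) auto
  \<comment> \<open>Here 504300 = 205 * (12 * 205): a factor 205 from \<open>X\<close>, and 12 * 205
    from the two digits that each stage of \<open>?A\<close> adds.\<close>
  then show ?thesis
    by (simp add: card_ruzsa R nat_power_eq flip: power_mult_distrib)
qed

text \<open>
  Follows from \<open>0.4668 < 204 / 437 \<le> log 205 12\<close>; the factor \<open>80 / 81\<close> splits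
  \<open>205 ^ 204 \<le> 12 ^ 437\<close> along \<open>204 = 29 * 7 + 1\<close> and \<open>437 = 29 * 15 + 2\<close>.
\<close>

lemma exponent_bound: "(42025 :: real) powr 1.2334 \<le> 504300"
proof -
  have ln_mult_power: "ln (a * b ^ n) = ln a + n * ln b" if "a > 0" "b > 0" for a b :: real and n
    using that by (simp add: ln_mult_pos ln_realpow)
  have "ln (81 * 205 ^ 7 :: real) \<le> ln (80 * 12 ^ 15)"
    by (subst ln_le_cancel_iff) simp_all
  then have "ln 81 + 7 * ln 205 \<le> ln 80 + 15 * ln (12 :: real)"
    by (simp only: ln_mult_power zero_less_numeral of_nat_numeral)
  moreover have "ln (205 * 80 ^ 29 :: real) \<le> ln (144 * 81 ^ 29)"
    by (subst ln_le_cancel_iff) simp_all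
  then have "ln 205 + 29 * ln 80 \<le> ln 144 + 29 * ln (81 :: real)"
    by (simp only: ln_mult_power zero_less_numeral of_nat_numeral)
  moreover have "ln 144 = 2 * ln (12 :: real)" "ln 42025 = 2 * ln (205 :: real)"
    using ln_realpow[of "12 :: real" 2] ln_realpow[of "205 :: real" 2] by simp_all
  moreover have "ln 504300 = ln 12 + 2 * ln (205 :: real)"
    using ln_mult_power[of 12 205 2] by simp
  moreover have "0 < ln (205 :: real)" by simp
  \<comment> \<open>29 times the first inequality plus the second cancels \<open>ln 80\<close> and
    \<open>ln 81\<close>, leaving \<open>204 * ln 205 \<le> 437 * ln 12\<close>.\<close>
  ultimately have "12334 * ln 42025 \<le> 10000 * ln (504300 :: real)"
    by linarith
  then have "1.2334 * ln 42025 \<le> ln (504300 :: real)"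
    by simp
  then have "exp (1.2334 * ln 42025) \<le> exp (ln (504300 :: real))"
    by (simp only: exp_le_cancel_iff)
  then show ?thesis by (simp add: powr_def)
qed

theorem theorem1p2:
  shows "\<exists>c::real. c > 0 \<and>
    (\<forall>q::nat. prime q \<longrightarrow> real (IM (residue_ring (int q)) 2) \<ge> c * real q powr 1.2334)"
proof (intro exI conjI allI impI)
  \<comment> \<open>84050 = 2 * 42025 pays for the condition \<open>2 * N \<le> q\<close> and for
    rounding \<open>q div 2\<close> down to a power of 42025.\<close>
  let ?c = "84050 powr - 1.2334 :: real"
  show "?c > 0" by simp
  fix q :: nat assume "prime q"
  then have q: "q \<ge> 2" by (rule prime_ge_2_nat)
  \<comment> \<open>The largest admissible \<open>k\<close>; it exists because
    \<open>q div 2\<close> is at least 1.\<close>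
  obtain k where "42025 ^ k \<le> q div 2" "q div 2 < 42025 ^ Suc k"
    using ex_power_ivl1[of 42025 "q div 2"] q unfolding Suc_eq_plus1 by fastforce
  then have k: "2 * 42025 ^ k \<le> q" "q < 2 * 42025 ^ Suc k" by linarith+
  have "real q \<le> 84050 * 42025 ^ k"
  proof -
    have "real q \<le> real (2 * 42025 ^ Suc k)" using k(2) by (intro of_nat_mono) simp
    then show ?thesis by simp
  qed
  then have "real q powr 1.2334 \<le> (84050 * 42025 ^ k) powr 1.2334"
    by (intro powr_mono2) auto
  also have "\<dots> = 84050 powr 1.2334 * (42025 powr 1.2334) ^ k"
    by (simp add: powr_mult powr_power flip: powr_realpow) (simp add: powr_powr mult.commute)
  also have "\<dots> \<le> 84050 powr 1.2334 * 504300 ^ k"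
    using exponent_bound by (intro mult_left_mono power_mono) auto
  finally have "?c * real q powr 1.2334 \<le> ?c * (84050 powr 1.2334 * 504300 ^ k)"
    by (intro mult_left_mono) auto
  also have "\<dots> = 504300 ^ k" by (simp add: powr_minus)
  also have "\<dots> = real (504300 ^ k)" by simp
  also have "\<dots> \<le> real (IM (residue_ring (int q)) 2)"
    using k(1) q by (intro of_nat_mono power_le_IM) auto
  finally show "?c * real q powr 1.2334 \<le> real (IM (residue_ring (int q)) 2)" .
qed

end
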